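(* Let $\beta>2$ be fixed and let $X_1,X_2,\ldots$ be i.i.d. random variables with a continuous distribution, defined on a common probability space $(\Omega,\mathcal{A},\mathbb{P})$. Assume that $X_1$ has a non-degenerate distribution, and that the moment generating function $M(t)=\mathbb{E}\exp(tX_1)$ exists for each $t\in\mathbb{R}$. Then $$\liminf_{n\to\infty}\frac{T_{n,\beta}}{n}\ \ge\ \int_{\mathbb{R}}\left(M(t)-M_0(t)\right)^2 e^{-\beta t^2}\,dt\qquad \mathbb{P}\text{-a.s.},$$ where $M_0(t)=\exp(t^2/2)$, $t\in\mathbb{R}$, is the moment generating function of the standard normal distribution, and $T_{n,\beta}=n\int_{-\infty}^{\infty}(M_n(t)-M_0(t))^2\exp(-\beta t^2)\,dt$, with $M_n$ the empirical moment generating function of the scaled residuals of $X_1,\ldots,X_n$.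
   Context: Put $\overline{X}_n=n^{-1}\sum_{j=1}^n X_j$ (sample mean), $S_n^2=n^{-1}\sum_{j=1}^n (X_j-\overline{X}_n)^2$ (sample variance), and $S_n=\sqrt{S_n^2}$. The scaled residuals are $Y_{n,j}=(X_j-\overline{X}_n)/S_n$, $j=1,\ldots,n$, and their empirical moment generating function is $M_n(t)=\frac1n\sum_{j=1}^n \exp(tY_{n,j})$, $t\in\mathbb{R}$. The statistic $T_{n,\beta}$ is used to test the hypothesis that the distribution of $X_1$ is a non-degenerate normal distribution; large values lead to rejection.
   Formalization: As displayed the claim fails for unstandardized X_1 (e.g. N(5,1)), since T_{n,β} is affine invariant and M is not; it is proved with M the moment generating function of (X_1−E X_1)/sqrt(Var X_1), and with M(t)=E exp(tX_1) itself when E X_1=0 and Var X_1=1. *)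

theory Defs
  imports "HOL-Probability.Probability"
begin

text \<open>
  A sample path is a function \<open>x :: nat \<Rightarrow> real\<close> whose first \<open>n\<close> observations are
  \<open>x 1, \<dots>, x n\<close>; the value \<open>x 0\<close> is never used.
\<close>

definition sample_mean :: "(nat \<Rightarrow> real) \<Rightarrow> nat \<Rightarrow> real" where
  "sample_mean x n = (\<Sum>j=1..n. x j) / real n"

definition sample_variance :: "(nat \<Rightarrow> real) \<Rightarrow> nat \<Rightarrow> real" where
  "sample_variance x n = (\<Sum>j=1..n. (x j - sample_mean x n)\<^sup>2) / real n"

text \<open>
  If the sample variance vanishes, the residuals are \<open>0\<close> by the convention for division by zero.
  For independent observations from a continuous distribution and \<open>n \<ge> 2\<close> this is a null event.
\<close>

definition scaled_residual :: "(nat \<Rightarrow> real) \<Rightarrow> nat \<Rightarrow> nat \<Rightarrow> real" where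
  "scaled_residual x n j = (x j - sample_mean x n) / sqrt (sample_variance x n)"

definition empirical_mgf :: "(nat \<Rightarrow> real) \<Rightarrow> nat \<Rightarrow> real \<Rightarrow> real" where
  "empirical_mgf x n t = (\<Sum>j=1..n. exp (t * scaled_residual x n j)) / real n"

definition std_normal_mgf :: "real \<Rightarrow> real" where
  "std_normal_mgf t = exp (t\<^sup>2 / 2)"

text \<open>
  The integrand is dominated by a multiple of \<open>exp (c * \<bar>t\<bar> + t\<^sup>2 - \<beta> * t\<^sup>2)\<close> for some \<open>c\<close>,
  so for \<open>\<beta> > 1\<close> it is integrable and the Bochner integral is the intended real number.
\<close>

definition T_stat :: "real \<Rightarrow> (nat \<Rightarrow> real) \<Rightarrow> nat \<Rightarrow> real" where
  "T_stat \<beta> x n =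
     real n * (\<integral>t. (empirical_mgf x n t - std_normal_mgf t)\<^sup>2 * exp (- \<beta> * t\<^sup>2) \<partial>lborel)"

definition mgf :: "'a measure \<Rightarrow> ('a \<Rightarrow> real) \<Rightarrow> real \<Rightarrow> real" where
  "mgf P Y t = (\<integral>\<omega>. exp (t * Y \<omega>) \<partial>P)"

text \<open>
  \<open>T_stat\<close> is invariant under positive affine transformations of the observations, whereas \<open>mgf\<close>
  is not, so the limiting moment generating function is that of the standardized variable; it is
  \<open>mgf P Y\<close> itself when \<open>Y\<close> has mean \<open>0\<close> and variance \<open>1\<close>.
\<close>

definition standardized :: "'a measure \<Rightarrow> ('a \<Rightarrow> real) \<Rightarrow> 'a \<Rightarrow> real" where
  "standardized P Y \<omega> =
     (Y \<omega> - prob_space.expectation P Y) / sqrt (prob_space.variance P Y)"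

text \<open>
  The weighted squared distance between a moment generating function and that of the standard
  normal distribution can be infinite, hence the extended nonnegative integral.
\<close>

definition mgf_distance :: "real \<Rightarrow> (real \<Rightarrow> real) \<Rightarrow> ennreal" where
  "mgf_distance \<beta> m =
     (\<integral>\<^sup>+t. ennreal ((m t - std_normal_mgf t)\<^sup>2 * exp (- \<beta> * t\<^sup>2)) \<partial>lborel)"

end

theory Submission
  imports Defs
begin

text \<open>
  Since \<open>M\<close> is finite everywhere, \<open>X\<^sub>1\<close>, \<open>X\<^sub>1\<^sup>2\<close> and \<open>exp (q X\<^sub>1)\<close> have finite fourth moments, and the
  elementary fourth-moment strong law makes the sample mean, the sample variance and, for all rational
  \<open>q\<close> at once, the unstandardized empirical moment generating functions converge almost surely.
  By convexity, convergence at rational points implies convergence along every convergent sequence of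
  arguments, in particular at \<open>t / S\<^sub>n\<close>. Hence \<open>M\<^sub>n\<close> converges pointwise to the moment generating
  function of the standardized variable, and Fatou's lemma gives the bound.
\<close>

section \<open>A moment inequality and convergence of convex functions at a moving point\<close>

lemma abs_power_le_fourth:
  fixes x :: real
  assumes "k \<le> 4"
  shows "\<bar>x\<bar> ^ k \<le> 1 + x ^ 4"
proof (cases "\<bar>x\<bar> \<le> 1")
  case True
  then have "\<bar>x\<bar> ^ k \<le> 1" by (simp add: power_le_one)
  then show ?thesis by (simp add: add_increasing2)
next
  case False
  then have "\<bar>x\<bar> ^ k \<le> \<bar>x\<bar> ^ 4" using assms by (intro power_increasing) auto
  then show ?thesis by simp
qed

text \<open>Convexity replaces equicontinuity. Rational points \<open>a\<close> and \<open>b\<close>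
  on both sides of \<open>u\<close> bound \<open>f n\<close> from above on the whole segment between
  them. For the bound from below, a rational \<open>r\<close> near \<open>u\<close> is the midpoint
  of \<open>U n\<close> and its reflection \<open>2 * r - U n\<close>: the value at the reflection
  is bounded above and the value at \<open>r\<close> is under control, so the value at
  \<open>U n\<close> cannot be small.\<close>

lemma convex_tendsto_moving_point:
  fixes f :: "nat \<Rightarrow> real \<Rightarrow> real"
  assumes convex: "\<And>n. convex_on UNIV (f n)"
    and lim: "\<And>q. q \<in> \<rat> \<Longrightarrow> (\<lambda>n. f n q) \<longlonglongrightarrow> g q"
    and cont: "isCont g u" and u: "U \<longlonglongrightarrow> u"
  shows "(\<lambda>n. f n (U n)) \<longlonglongrightarrow> g u"
proof (rule tendstoI)
  fix \<epsilon> :: real assume "\<epsilon> > 0"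
  \<comment> \<open>The bounds below give at most \<open>g u + 2 * e\<close> from above and at least
    2 (g u - 2 e) - (g u + 2 e) = g u - 6 e from below.\<close>
  define e where "e = \<epsilon> / 8"
  have e: "e > 0" "\<epsilon> = 8 * e" using \<open>\<epsilon> > 0\<close> by (auto simp: e_def)
  obtain d where d: "d > 0" and near: "\<And>y. \<bar>y - u\<bar> < d \<Longrightarrow> \<bar>g y - g u\<bar> < e"
    using cont e(1) unfolding continuous_at_eps_delta dist_real_def by blast
  \<comment> \<open>The segment from \<open>a\<close> to \<open>b\<close> contains all points within
    d/2 of \<open>u\<close>. With \<open>U n\<close> within d/4 and \<open>r\<close> within d/8 of
    \<open>u\<close>, the reflection is off by less than 2 d/8 + d/4 = d/2.\<close>
  obtain a where a: "a \<in> \<rat>" "u - d < a" "a < u - d / 2"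
    using Rats_dense_in_real[of "u - d" "u - d / 2"] d by auto
  obtain b where b: "b \<in> \<rat>" "u + d / 2 < b" "b < u + d"
    using Rats_dense_in_real[of "u + d / 2" "u + d"] d by auto
  obtain r where r: "r \<in> \<rat>" "u - d / 8 < r" "r < u + d / 8"
    using Rats_dense_in_real[of "u - d / 8" "u + d / 8"] d by auto
  have ev: "\<forall>\<^sub>F n in sequentially. dist (f n q) (g q) < e" if "q \<in> \<rat>" for q
    using lim[OF that] e(1) by (rule tendstoD)
  have "\<forall>\<^sub>F n in sequentially. dist (U n) u < d / 4"
    using u d by (intro tendstoD) auto
  then show "\<forall>\<^sub>F n in sequentially. dist (f n (U n)) (g u) < \<epsilon>"
    using ev[OF a(1)] ev[OF b(1)] ev[OF r(1)]
  proof eventually_elim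
    case (elim n)
    have ga: "\<bar>g a - g u\<bar> < e" and gb: "\<bar>g b - g u\<bar> < e" and gr: "\<bar>g r - g u\<bar> < e"
      using a b r d by (auto intro!: near)
    have upper: "f n y < g u + 2 * e" if "a \<le> y" "y \<le> b" for y
    proof -
      have "y \<in> closed_segment a b" using that by (simp add: closed_segment_eq_real_ivl)
      then obtain t where t: "0 \<le> t" "t \<le> 1" "y = (1 - t) *\<^sub>R a + t *\<^sub>R b"
        unfolding in_segment by blast
      then have "f n y \<le> max (f n a) (f n b)"
        using convex_lower[OF convex, of a b "1 - t" t] by simp
      then show ?thesis using elim ga gb by (auto simp: dist_real_def)
    qed
    have "\<bar>U n - u\<bar> < d / 4" using elim(1) by (simp add: dist_real_def)
    then have "a \<le> U n" "U n \<le> b" "a \<le> 2 * r - U n" "2 * r - U n \<le> b"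
      using a b r by linarith+
    then have "f n (U n) < g u + 2 * e" "f n (2 * r - U n) < g u + 2 * e"
      by (auto intro: upper)
    moreover have "f n r \<le> (f n (U n) + f n (2 * r - U n)) / 2"
      using convex_onD[OF convex[of n], of "1 / 2" "U n" "2 * r - U n"] by (simp add: algebra_simps)
    moreover have "g u - 2 * e < f n r" using elim gr by (auto simp: dist_real_def)
    ultimately show ?case using e by (auto simp: dist_real_def abs_if)
  qed
qed

section \<open>Integrability of the statistic's integrand\<close>

text \<open>Completing the square gives a multiple of the normal density with mean c/(2b) and
  variance 1/(2b).\<close>

lemma integrable_exp_quadratic:
  fixes b c :: real
  assumes "b > 0"
  shows "integrable lborel (\<lambda>t. exp (c * t - b * t\<^sup>2))"
proof -
  define s where "s = 1 / sqrt (2 * b)"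
  have s: "s\<^sup>2 = 1 / (2 * b)" using assms by (simp add: s_def power_divide)
  have eq: "exp (c * t - b * t\<^sup>2)
      = exp (c\<^sup>2 / (4 * b)) * sqrt (2 * pi * s\<^sup>2) * normal_density (c / (2 * b)) s t" for t
  proof -
    have "c * t - b * t\<^sup>2 = c\<^sup>2 / (4 * b) + (- (t - c / (2 * b))\<^sup>2 / (2 * s\<^sup>2))"
      using assms unfolding s by (simp add: field_simps power2_eq_square)
    then have "exp (c * t - b * t\<^sup>2) = exp (c\<^sup>2 / (4 * b)) * exp (- (t - c / (2 * b))\<^sup>2 / (2 * s\<^sup>2))"
      by (simp only: exp_add)
    moreover have "sqrt (2 * pi * s\<^sup>2) \<noteq> 0" using assms by (simp add: s)
    ultimately show ?thesis by (simp add: normal_density_def)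
  qed
  have "s > 0" using assms by (simp add: s_def)
  then show ?thesis unfolding eq by simp
qed

text \<open>Expanding the square leaves a finite combination of Gaussian exponentials with quadratic
  coefficients \<open>\<beta>\<close>, \<open>\<beta> - 1 / 2\<close> and
  \<open>\<beta> - 1\<close>. The last one, from the squared normal moment generating function, is
  where \<open>\<beta> > 1\<close> enters.\<close>

lemma integrable_T_stat_integrand:
  assumes "\<beta> > 1"
  shows "integrable lborel (\<lambda>t. (empirical_mgf x n t - std_normal_mgf t)\<^sup>2 * exp (- \<beta> * t\<^sup>2))"
proof -
  define y where "y = scaled_residual x n"
  have eq: "(empirical_mgf x n t - std_normal_mgf t)\<^sup>2 * exp (- \<beta> * t\<^sup>2)
      = (\<Sum>i=1..n. \<Sum>j=1..n. exp ((y i + y j) * t - \<beta> * t\<^sup>2)) / (real n)\<^sup>2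
        - 2 * (\<Sum>j=1..n. exp (y j * t - (\<beta> - 1 / 2) * t\<^sup>2)) / real n
        + exp (0 * t - (\<beta> - 1) * t\<^sup>2)" for t
  proof -
    define E where "E = (\<Sum>j=1..n. exp (t * y j))"
    have 1: "(\<Sum>i=1..n. \<Sum>j=1..n. exp ((y i + y j) * t - \<beta> * t\<^sup>2)) = E\<^sup>2 * exp (- \<beta> * t\<^sup>2)"
      unfolding E_def power2_eq_square[of "sum _ _"] sum_product
      unfolding sum_distrib_right
      by (intro sum.cong refl) (simp add: algebra_simps flip: exp_add)
    have 2: "(\<Sum>j=1..n. exp (y j * t - (\<beta> - 1 / 2) * t\<^sup>2)) = E * (exp (t\<^sup>2 / 2) * exp (- \<beta> * t\<^sup>2))"
      unfolding E_def sum_distrib_right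
      by (intro sum.cong refl) (simp add: algebra_simps flip: exp_add)
    have 3: "exp (0 * t - (\<beta> - 1) * t\<^sup>2) = (exp (t\<^sup>2 / 2))\<^sup>2 * exp (- \<beta> * t\<^sup>2)"
      by (simp add: power2_eq_square[of "exp _"] algebra_simps flip: exp_add)
    show ?thesis
      unfolding 1 2 3 empirical_mgf_def std_normal_mgf_def y_def[symmetric] E_def[symmetric]
      by (simp add: power2_diff power_divide algebra_simps)
  qed
  show ?thesis
    unfolding eq using assms
    by (intro Bochner_Integration.integrable_add Bochner_Integration.integrable_diff integrable_divide
        integrable_mult_right Bochner_Integration.integrable_sum
        integrable_exp_quadratic) auto
qed

text \<open>Integrability identifies the Bochner integral in \<open>T_stat\<close> with a
  nonnegative integral, the form to which Fatou's lemma applies.\<close>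

lemma ennreal_T_stat:
  assumes "\<beta> > 1" "n > 0"
  shows "ennreal (T_stat \<beta> x n / real n) = mgf_distance \<beta> (empirical_mgf x n)"
  using nn_integral_eq_integral[OF integrable_T_stat_integrand[OF assms(1)], of x n] assms(2)
  by (simp add: T_stat_def mgf_distance_def)

section \<open>Reduction of the statistic to plain averages\<close>

lemma sample_variance_eq:
  assumes "n > 0"
  shows "sample_variance x n = (\<Sum>j=1..n. (x j)\<^sup>2) / real n - (sample_mean x n)\<^sup>2"
proof -
  define m where "m = sample_mean x n"
  have s: "(\<Sum>j=1..n. x j) = real n * m" using assms by (simp add: m_def sample_mean_def)
  have "(\<Sum>j=1..n. (x j - m)\<^sup>2) = (\<Sum>j=1..n. (x j)\<^sup>2) - 2 * m * (\<Sum>j=1..n. x j) + real n * m\<^sup>2"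
    by (simp add: power2_diff sum.distrib sum_subtractf sum_distrib_left sum_distrib_right mult_ac)
  then show ?thesis
    unfolding sample_variance_def m_def[symmetric] s using assms by (simp add: field_simps power2_eq_square)
qed

text \<open>Standardization is moved out of the residuals and into the argument: what remains is the
  average of \<open>exp (u * x j)\<close> at a path-dependent point \<open>u\<close>, to which the
  moving-point lemma applies. If the sample variance is zero, the convention for division by zero
  keeps both sides equal.\<close>

lemma empirical_mgf_eq:
  "empirical_mgf x n t = exp (- (t / sqrt (sample_variance x n) * sample_mean x n))
     * ((\<Sum>j=1..n. exp (t / sqrt (sample_variance x n) * x j)) / real n)"
proof -
  define s m where "s = sqrt (sample_variance x n)" and "m = sample_mean x n"
  have "exp (t * ((x j - m) / s)) = exp (- (t / s * m)) * exp (t / s * x j)" for j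
    by (simp add: diff_divide_distrib right_diff_distrib flip: exp_add)
  then show ?thesis
    unfolding empirical_mgf_def scaled_residual_def s_def[symmetric] m_def[symmetric]
    by (simp add: sum_distrib_left)
qed

lemma convex_on_exp_mult: "convex_on UNIV (\<lambda>t. exp (t * c))" for c :: real
proof (rule convex_onI)
  fix t x y :: real assume "0 < t" "t < 1"
  then have "exp ((1 - t) *\<^sub>R (x * c) + t *\<^sub>R (y * c)) \<le> (1 - t) * exp (x * c) + t * exp (y * c)"
    by (intro convex_onD[OF exp_convex]) auto
  then show "exp (((1 - t) *\<^sub>R x + t *\<^sub>R y) * c) \<le> (1 - t) * exp (x * c) + t * exp (y * c)"
    by (simp add: algebra_simps)
qed simp

section \<open>The lower bound along one sample path\<close>

text \<open>The deterministic core: once the averages of one path converge, no probability is left.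
  The function on the left is the pointwise limit of the empirical moment generating functions of
  the residuals; for \<open>G\<close> the moment generating function of the observations it is that
  of the standardized variable.\<close>

lemma liminf_T_stat_ge:
  fixes x :: "nat \<Rightarrow> real"
  assumes "\<beta> > 1"
    and mean: "(\<lambda>n. (\<Sum>j=1..n. x j) / real n) \<longlonglongrightarrow> \<mu>"
    and square: "(\<lambda>n. (\<Sum>j=1..n. (x j)\<^sup>2) / real n) \<longlonglongrightarrow> \<sigma>\<^sup>2 + \<mu>\<^sup>2" and "\<sigma> > 0"
    and mgf: "\<And>q. q \<in> \<rat> \<Longrightarrow> (\<lambda>n. (\<Sum>j=1..n. exp (q * x j)) / real n) \<longlonglongrightarrow> G q"
    and cont: "continuous_on UNIV G"
  shows "mgf_distance \<beta> (\<lambda>t. exp (- (t / \<sigma> * \<mu>)) * G (t / \<sigma>))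
    \<le> liminf (\<lambda>n. ennreal (T_stat \<beta> x n / real n))"
proof -
  have m: "sample_mean x \<longlonglongrightarrow> \<mu>"
    using mean unfolding sample_mean_def[abs_def] .
  have "(\<lambda>n. (\<Sum>j=1..n. (x j)\<^sup>2) / real n - (sample_mean x n)\<^sup>2) \<longlonglongrightarrow> \<sigma>\<^sup>2 + \<mu>\<^sup>2 - \<mu>\<^sup>2"
    by (intro tendsto_diff tendsto_power square m)
  moreover have "\<forall>\<^sub>F n in sequentially. (\<Sum>j=1..n. (x j)\<^sup>2) / real n - (sample_mean x n)\<^sup>2
      = sample_variance x n"
    using eventually_gt_at_top[of 0] by eventually_elim (simp add: sample_variance_eq)
  ultimately have "sample_variance x \<longlonglongrightarrow> \<sigma>\<^sup>2" by (simp add: tendsto_cong)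
  then have "(\<lambda>n. sqrt (sample_variance x n)) \<longlonglongrightarrow> sqrt (\<sigma>\<^sup>2)" by (rule tendsto_real_sqrt)
  then have s: "(\<lambda>n. sqrt (sample_variance x n)) \<longlonglongrightarrow> \<sigma>" using \<open>\<sigma> > 0\<close> by simp
  define A where "A n t = (\<Sum>j=1..n. exp (t * x j)) / real n" for n t
  have A_convex: "convex_on UNIV (A n)" for n
  proof -
    have "convex_on UNIV (\<lambda>t. \<Sum>j=1..k. exp (t * x j))" for k
      by (induction k) (auto intro!: convex_on_add convex_on_exp_mult simp: convex_on_const)
    then have "convex_on UNIV (\<lambda>t. (1 / real n) * (\<Sum>j=1..n. exp (t * x j)))"
      by (intro convex_on_cmul) auto
    then show ?thesis by (simp add: A_def[abs_def])
  qed
  have A_lim: "(\<lambda>n. A n q) \<longlonglongrightarrow> G q" if "q \<in> \<rat>" for q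
    using mgf[OF that] unfolding A_def .
  have lim: "(\<lambda>n. empirical_mgf x n t) \<longlonglongrightarrow> exp (- (t / \<sigma> * \<mu>)) * G (t / \<sigma>)" for t
  proof -
    have u: "(\<lambda>n. t / sqrt (sample_variance x n)) \<longlonglongrightarrow> t / \<sigma>"
      using \<open>\<sigma> > 0\<close> by (intro tendsto_divide tendsto_const s) simp
    have "isCont G (t / \<sigma>)" using cont by (simp add: continuous_on_eq_continuous_at)
    then have "(\<lambda>n. A n (t / sqrt (sample_variance x n))) \<longlonglongrightarrow> G (t / \<sigma>)"
      by (intro convex_tendsto_moving_point[where f = A and g = G and u = "t / \<sigma>" and U = "\<lambda>n. t / sqrt (sample_variance x n)"]
          A_convex u A_lim)
    moreover have "(\<lambda>n. - (t / sqrt (sample_variance x n) * sample_mean x n)) \<longlonglongrightarrow> - (t / \<sigma> * \<mu>)"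
      using tendsto_mult[OF u m] by (rule tendsto_minus)
    ultimately show ?thesis
      unfolding empirical_mgf_eq A_def by (intro tendsto_mult tendsto_exp)
  qed
  define h where "h n t = ennreal ((empirical_mgf x n t - std_normal_mgf t)\<^sup>2 * exp (- \<beta> * t\<^sup>2))" for n t
  \<comment> \<open>Since the integrands converge pointwise, the limiting integrand is their liminf,
    as Fatou's lemma requires.\<close>
  have "mgf_distance \<beta> (\<lambda>t. exp (- (t / \<sigma> * \<mu>)) * G (t / \<sigma>)) = (\<integral>\<^sup>+t. liminf (\<lambda>n. h n t) \<partial>lborel)"
    unfolding mgf_distance_def
  proof (intro nn_integral_cong)
    fix t
    have "(\<lambda>n. h n t) \<longlonglongrightarrow> ennreal ((exp (- (t / \<sigma> * \<mu>)) * G (t / \<sigma>) - std_normal_mgf t)\<^sup>2 * exp (- \<beta> * t\<^sup>2))"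
      unfolding h_def by (intro tendsto_ennrealI tendsto_mult_right tendsto_power tendsto_diff lim tendsto_const)
    then show "ennreal ((exp (- (t / \<sigma> * \<mu>)) * G (t / \<sigma>) - std_normal_mgf t)\<^sup>2 * exp (- \<beta> * t\<^sup>2))
        = liminf (\<lambda>n. h n t)"
      by (intro lim_imp_Liminf[symmetric]) auto
  qed
  also have "\<dots> \<le> liminf (\<lambda>n. integral\<^sup>N lborel (h n))"
    by (rule nn_integral_liminf)
      (simp add: h_def[abs_def] empirical_mgf_def[abs_def] std_normal_mgf_def[abs_def])
  also have "\<dots> = liminf (\<lambda>n. ennreal (T_stat \<beta> x n / real n))"
  proof (rule Liminf_eq)
    show "\<forall>\<^sub>F n in sequentially. integral\<^sup>N lborel (h n) = ennreal (T_stat \<beta> x n / real n)"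
      using eventually_gt_at_top[of 0]
      by eventually_elim (use assms(1) in \<open>simp add: ennreal_T_stat mgf_distance_def h_def[abs_def]\<close>)
  qed
  finally show ?thesis .
qed

section \<open>A strong law under finite fourth moments\<close>

context prob_space
begin

lemma integrable_power_of_fourth:
  fixes Y :: "'a \<Rightarrow> real"
  assumes [measurable]: "random_variable borel Y" and Y4: "integrable M (\<lambda>\<omega>. Y \<omega> ^ 4)"
    and k: "k \<le> 4"
  shows "integrable M (\<lambda>\<omega>. Y \<omega> ^ k)"
proof (rule Bochner_Integration.integrable_bound)
  show "integrable M (\<lambda>\<omega>. 1 + Y \<omega> ^ 4)" using Y4 by simp
  show "AE \<omega> in M. norm (Y \<omega> ^ k) \<le> norm (1 + Y \<omega> ^ 4)"
    using abs_power_le_fourth[OF k] by (intro AE_I2) (auto simp: power_abs intro: order_trans[OF _ abs_ge_self])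
qed simp

lemma indep_var_power_mult:
  fixes Y Z :: "'a \<Rightarrow> real"
  assumes ind: "indep_var borel Y borel Z"
    and "integrable M (\<lambda>\<omega>. Y \<omega> ^ i)" "integrable M (\<lambda>\<omega>. Z \<omega> ^ k)"
  shows "integrable M (\<lambda>\<omega>. Y \<omega> ^ i * Z \<omega> ^ k)"
    and "expectation (\<lambda>\<omega>. Y \<omega> ^ i * Z \<omega> ^ k) =
      expectation (\<lambda>\<omega>. Y \<omega> ^ i) * expectation (\<lambda>\<omega>. Z \<omega> ^ k)"
proof -
  have "indep_var borel ((\<lambda>x. x ^ i) \<circ> Y) borel ((\<lambda>x. x ^ k) \<circ> Z)"
    by (rule indep_var_compose[OF ind]) auto
  then have *: "indep_var borel (\<lambda>\<omega>. Y \<omega> ^ i) borel (\<lambda>\<omega>. Z \<omega> ^ k)"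
    by (simp add: comp_def)
  show "integrable M (\<lambda>\<omega>. Y \<omega> ^ i * Z \<omega> ^ k)"
    by (rule indep_var_integrable[OF *]) (use assms in auto)
  show "expectation (\<lambda>\<omega>. Y \<omega> ^ i * Z \<omega> ^ k) =
      expectation (\<lambda>\<omega>. Y \<omega> ^ i) * expectation (\<lambda>\<omega>. Z \<omega> ^ k)"
    by (rule indep_var_lebesgue_integral[OF *]) (use assms in auto)
qed

text \<open>Induction, adding an independent centred summand \<open>Y\<close> to the partial sum
  \<open>S\<close>. Every mixed term with a first power of \<open>Y\<close> or \<open>S\<close> has
  mean zero, so only E S^4 + 6 E Y^2 E S^2 + E Y^4 survives and the growth is quadratic in n. The
  second-moment bound is carried along for the middle term, the integrability for the
  expansion.\<close>

lemma fourth_moment_sum: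
  fixes X :: "nat \<Rightarrow> 'a \<Rightarrow> real"
  assumes ind: "indep_vars (\<lambda>_. borel) X {1..}"
    and X4: "\<And>j. j \<ge> 1 \<Longrightarrow> integrable M (\<lambda>\<omega>. X j \<omega> ^ 4)"
    and mean: "\<And>j. j \<ge> 1 \<Longrightarrow> expectation (X j) = 0"
    and m2: "\<And>j. j \<ge> 1 \<Longrightarrow> expectation (\<lambda>\<omega>. X j \<omega> ^ 2) \<le> C"
    and m4: "\<And>j. j \<ge> 1 \<Longrightarrow> expectation (\<lambda>\<omega>. X j \<omega> ^ 4) \<le> C"
    and C: "1 \<le> C"
  shows "integrable M (\<lambda>\<omega>. (\<Sum>j=1..n. X j \<omega>) ^ 4)
    \<and> expectation (\<lambda>\<omega>. (\<Sum>j=1..n. X j \<omega>) ^ 2) \<le> real n * C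
    \<and> expectation (\<lambda>\<omega>. (\<Sum>j=1..n. X j \<omega>) ^ 4) \<le> 3 * (real n)\<^sup>2 * C\<^sup>2"
proof (induction n)
  case 0
  then show ?case by simp
next
  case (Suc n)
  define S where "S \<omega> = (\<Sum>j=1..n. X j \<omega>)" for \<omega>
  define Y where "Y = X (Suc n)"
  have rv: "random_variable borel (X j)" if "j \<ge> 1" for j
    using ind that by (auto simp: indep_vars_def)
  have [measurable]: "random_variable borel S" "random_variable borel Y"
    unfolding S_def Y_def by (auto intro!: borel_measurable_sum rv)
  have S4: "integrable M (\<lambda>\<omega>. S \<omega> ^ 4)"
    and ES2: "expectation (\<lambda>\<omega>. S \<omega> ^ 2) \<le> real n * C"
    and ES4: "expectation (\<lambda>\<omega>. S \<omega> ^ 4) \<le> 3 * (real n)\<^sup>2 * C\<^sup>2"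
    using Suc.IH by (auto simp: S_def)
  have Y4: "integrable M (\<lambda>\<omega>. Y \<omega> ^ 4)" unfolding Y_def by (rule X4) simp
  have Sk: "integrable M (\<lambda>\<omega>. S \<omega> ^ k)" if "k \<le> 4" for k
    by (rule integrable_power_of_fourth[OF _ S4 that]) simp
  have Yk: "integrable M (\<lambda>\<omega>. Y \<omega> ^ k)" if "k \<le> 4" for k
    by (rule integrable_power_of_fourth[OF _ Y4 that]) simp
  have EY: "expectation Y = 0" "expectation (\<lambda>\<omega>. Y \<omega> ^ 2) \<le> C" "expectation (\<lambda>\<omega>. Y \<omega> ^ 4) \<le> C"
    unfolding Y_def using mean m2 m4 by auto
  have ES1: "expectation S = 0"
  proof -
    have "integrable M (X j)" if "j \<ge> 1" for j
      using integrable_power_of_fourth[OF rv[OF that] X4[OF that], of 1] by simp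
    then show ?thesis unfolding S_def using mean by simp
  qed
  have "indep_var borel Y borel S"
    unfolding Y_def S_def by (rule indep_vars_sum) (auto intro: indep_vars_subset[OF ind])
  note YS = indep_var_power_mult[OF this]
  have int: "integrable M (\<lambda>\<omega>. Y \<omega> ^ i * S \<omega> ^ k)"
    and E: "expectation (\<lambda>\<omega>. Y \<omega> ^ i * S \<omega> ^ k) =
      expectation (\<lambda>\<omega>. Y \<omega> ^ i) * expectation (\<lambda>\<omega>. S \<omega> ^ k)" if "i \<le> 4" "k \<le> 4" for i k
    using YS[OF Yk Sk] that by auto
  have sum: "(\<Sum>j=1..Suc n. X j \<omega>) = S \<omega> + Y \<omega>" for \<omega>
    by (simp add: S_def Y_def)
  \<comment> \<open>First powers are written with an explicit exponent so that every mixed term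
    matches \<open>int\<close> and \<open>E\<close>.\<close>
  have exp2: "(S \<omega> + Y \<omega>) ^ 2 = S \<omega> ^ 2 + 2 * (Y \<omega> ^ 1 * S \<omega> ^ 1) + Y \<omega> ^ 2" for \<omega>
    by (simp add: power2_sum)
  have exp4: "(S \<omega> + Y \<omega>) ^ 4 = S \<omega> ^ 4 + 4 * (Y \<omega> ^ 1 * S \<omega> ^ 3) + 6 * (Y \<omega> ^ 2 * S \<omega> ^ 2)
      + 4 * (Y \<omega> ^ 3 * S \<omega> ^ 1) + Y \<omega> ^ 4" for \<omega>
    by algebra
  note ints = int[of 1 1] int[of 1 3] int[of 2 2] int[of 3 1] Sk[of 2] Yk[of 2] S4 Y4
  have "expectation (\<lambda>\<omega>. (S \<omega> + Y \<omega>) ^ 2) =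
      expectation (\<lambda>\<omega>. S \<omega> ^ 2) + expectation (\<lambda>\<omega>. Y \<omega> ^ 2)"
    unfolding exp2 using ints E[of 1 1] EY(1) by simp
  also have "\<dots> \<le> real (Suc n) * C" using ES2 EY(2) by (simp add: algebra_simps)
  finally have A: "expectation (\<lambda>\<omega>. (S \<omega> + Y \<omega>) ^ 2) \<le> real (Suc n) * C" .
  have B: "integrable M (\<lambda>\<omega>. (S \<omega> + Y \<omega>) ^ 4)"
    unfolding exp4 using ints by simp
  have "expectation (\<lambda>\<omega>. (S \<omega> + Y \<omega>) ^ 4) = expectation (\<lambda>\<omega>. S \<omega> ^ 4)
      + 6 * (expectation (\<lambda>\<omega>. Y \<omega> ^ 2) * expectation (\<lambda>\<omega>. S \<omega> ^ 2)) + expectation (\<lambda>\<omega>. Y \<omega> ^ 4)"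
    unfolding exp4 using ints E[of 1 3] E[of 2 2] E[of 3 1] EY(1) ES1 by simp
  also have "\<dots> \<le> 3 * (real n)\<^sup>2 * C\<^sup>2 + 6 * (C * (real n * C)) + C"
    using C by (intro add_mono mult_left_mono mult_mono ES4 ES2 EY) auto
  \<comment> \<open>The remainder \<open>C\<close> is absorbed using \<open>1 \<le> C\<close>, which
    completes 3 n^2 + 6 n + 3 = 3 (n + 1)^2.\<close>
  also have "C \<le> 3 * C\<^sup>2" using C by (simp add: power2_eq_square)
  then have "3 * (real n)\<^sup>2 * C\<^sup>2 + 6 * (C * (real n * C)) + C \<le> 3 * (real (Suc n))\<^sup>2 * C\<^sup>2"
    by (simp add: power2_eq_square algebra_simps)
  finally have "expectation (\<lambda>\<omega>. (S \<omega> + Y \<omega>) ^ 4) \<le> 3 * (real (Suc n))\<^sup>2 * C\<^sup>2" .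
  then show ?case using A B unfolding sum by simp
qed

text \<open>The fourth moment of the n-th average is O(1/n^2), hence summable. So the series of
  fourth powers of the averages has finite expectation, is finite almost surely, and its terms tend
  to zero.\<close>

lemma strong_law_centred:
  fixes X :: "nat \<Rightarrow> 'a \<Rightarrow> real"
  assumes ind: "indep_vars (\<lambda>_. borel) X {1..}"
    and X4: "\<And>j. j \<ge> 1 \<Longrightarrow> integrable M (\<lambda>\<omega>. X j \<omega> ^ 4)"
    and mean: "\<And>j. j \<ge> 1 \<Longrightarrow> expectation (X j) = 0"
    and m2: "\<And>j. j \<ge> 1 \<Longrightarrow> expectation (\<lambda>\<omega>. X j \<omega> ^ 2) \<le> C"
    and m4: "\<And>j. j \<ge> 1 \<Longrightarrow> expectation (\<lambda>\<omega>. X j \<omega> ^ 4) \<le> C"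
    and C: "1 \<le> C"
  shows "AE \<omega> in M. (\<lambda>n. (\<Sum>j=1..n. X j \<omega>) / real n) \<longlonglongrightarrow> 0"
proof -
  define D where "D n \<omega> = ((\<Sum>j=1..n. X j \<omega>) / real n) ^ 4" for n \<omega>
  note mom = fourth_moment_sum[OF assms]
  have rv: "random_variable borel (X j)" if "j \<ge> 1" for j
    using ind that by (auto simp: indep_vars_def)
  have [measurable]: "random_variable borel (D n)" for n
    unfolding D_def by (intro borel_measurable_power borel_measurable_divide borel_measurable_sum rv) auto
  have bound: "(\<integral>\<^sup>+\<omega>. ennreal (D n \<omega>) \<partial>M) \<le> ennreal (3 * C\<^sup>2 * inverse (real n ^ 2))" for n
  proof -
    have "integrable M (D n)" unfolding D_def power_divide using mom[of n] by simp
    then have "(\<integral>\<^sup>+\<omega>. ennreal (D n \<omega>) \<partial>M) = ennreal (expectation (D n))"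
      by (rule nn_integral_eq_integral) (simp add: D_def)
    also have "expectation (D n) = expectation (\<lambda>\<omega>. (\<Sum>j=1..n. X j \<omega>) ^ 4) / real n ^ 4"
      unfolding D_def power_divide by simp
    also have "\<dots> \<le> 3 * (real n)\<^sup>2 * C\<^sup>2 / real n ^ 4"
      using mom[of n] by (intro divide_right_mono) auto
    \<comment> \<open>At n = 0 both sides are 0 by the convention for division by zero, so the
      series may start there.\<close>
    also have "\<dots> = 3 * C\<^sup>2 * inverse (real n ^ 2)"
      by (cases "n = 0") (auto simp: field_simps power2_eq_square eval_nat_numeral)
    finally show ?thesis by (simp add: ennreal_leI)
  qed
  have "(\<integral>\<^sup>+\<omega>. (\<Sum>n. ennreal (D n \<omega>)) \<partial>M) = (\<Sum>n. \<integral>\<^sup>+\<omega>. ennreal (D n \<omega>) \<partial>M)"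
    by (rule nn_integral_suminf) simp
  also have "\<dots> \<le> (\<Sum>n. ennreal (3 * C\<^sup>2 * inverse (real n ^ 2)))"
    by (intro suminf_le bound) auto
  also have "\<dots> < top"
    unfolding less_top[symmetric]
    by (intro ennreal_suminf_neq_top summable_mult inverse_power_summable) auto
  finally have "AE \<omega> in M. (\<Sum>n. ennreal (D n \<omega>)) \<noteq> \<infinity>"
    by (intro nn_integral_PInf_AE) auto
  then show ?thesis
  proof eventually_elim
    case (elim \<omega>)
    have "summable (\<lambda>n. D n \<omega>)"
      by (rule summable_suminf_not_top) (use elim in \<open>auto simp: D_def\<close>)
    then have "(\<lambda>n. root 4 (D n \<omega>)) \<longlonglongrightarrow> root 4 0"
      by (intro tendsto_real_root summable_LIMSEQ_zero)
    moreover have "root 4 (y ^ 4) = \<bar>y\<bar>" for y :: real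
      using real_root_power_cancel[of 4 "\<bar>y\<bar>"] by simp
    ultimately have "(\<lambda>n. \<bar>(\<Sum>j=1..n. X j \<omega>) / real n\<bar>) \<longlonglongrightarrow> 0"
      unfolding D_def real_root_zero by simp
    then show ?case by (rule tendsto_rabs_zero_cancel)
  qed
qed

text \<open>Centring reduces this to the previous law; equal distributions let the moments of the
  first centred variable serve as bounds for all. The function \<open>f\<close> will be the
  identity, the square and the exponentials \<open>exp (q * x)\<close>.\<close>

lemma strong_law_fourth_moment:
  fixes X :: "nat \<Rightarrow> 'a \<Rightarrow> real" and f :: "real \<Rightarrow> real"
  assumes ind: "indep_vars (\<lambda>_. borel) X {1..}"
    and iid: "\<And>j. j \<ge> 1 \<Longrightarrow> distr M borel (X j) = distr M borel (X 1)"
    and [measurable]: "f \<in> borel_measurable borel"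
    and f4: "integrable M (\<lambda>\<omega>. f (X 1 \<omega>) ^ 4)"
  shows "AE \<omega> in M. (\<lambda>n. (\<Sum>j=1..n. f (X j \<omega>)) / real n) \<longlonglongrightarrow> expectation (\<lambda>\<omega>. f (X 1 \<omega>))"
proof -
  define \<mu> where "\<mu> = expectation (\<lambda>\<omega>. f (X 1 \<omega>))"
  define Z where "Z j \<omega> = f (X j \<omega>) - \<mu>" for j \<omega>
  have rv: "random_variable borel (X j)" if "j \<ge> 1" for j
    using ind that by (auto simp: indep_vars_def)
  have transfer: "integrable M (\<lambda>\<omega>. g (X j \<omega>)) \<longleftrightarrow> integrable M (\<lambda>\<omega>. g (X 1 \<omega>))"
    "expectation (\<lambda>\<omega>. g (X j \<omega>)) = expectation (\<lambda>\<omega>. g (X 1 \<omega>))"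
    if [measurable]: "g \<in> borel_measurable borel" and j: "j \<ge> 1" for g :: "real \<Rightarrow> real" and j
    using integrable_distr_eq[OF rv[OF j], of g] integrable_distr_eq[OF rv[of 1], of g]
      integral_distr[OF rv[OF j], of g] integral_distr[OF rv[of 1], of g] iid[OF j] by auto
  have [measurable]: "random_variable borel (X 1)" by (rule rv) simp
  have fk: "integrable M (\<lambda>\<omega>. f (X 1 \<omega>) ^ k)" if "k \<le> 4" for k
    by (rule integrable_power_of_fourth[OF _ f4 that]) measurable
  have eq: "Z 1 \<omega> ^ 4 = f (X 1 \<omega>) ^ 4 - 4 * \<mu> * f (X 1 \<omega>) ^ 3 + 6 * \<mu> ^ 2 * f (X 1 \<omega>) ^ 2
      - 4 * \<mu> ^ 3 * f (X 1 \<omega>) ^ 1 + \<mu> ^ 4" for \<omega>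
    unfolding Z_def by algebra
  have Z4: "integrable M (\<lambda>\<omega>. Z 1 \<omega> ^ 4)"
    unfolding eq using fk[of 1] fk[of 2] fk[of 3] f4 by simp
  \<comment> \<open>The maximum with 1 meets the requirement \<open>1 \<le> C\<close> of the centred
    law.\<close>
  define C where "C = max 1 (max (expectation (\<lambda>\<omega>. Z 1 \<omega> ^ 2)) (expectation (\<lambda>\<omega>. Z 1 \<omega> ^ 4)))"
  have "AE \<omega> in M. (\<lambda>n. (\<Sum>j=1..n. Z j \<omega>) / real n) \<longlonglongrightarrow> 0"
  proof (rule strong_law_centred[where C = C])
    show "indep_vars (\<lambda>_. borel) Z {1..}"
      unfolding Z_def by (rule indep_vars_compose2[OF ind]) simp
    fix j :: nat assume j: "j \<ge> 1"
    show "integrable M (\<lambda>\<omega>. Z j \<omega> ^ 4)"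
      using transfer(1)[OF _ j, of "\<lambda>x. (f x - \<mu>) ^ 4"] Z4 by (simp add: Z_def)
    show "expectation (Z j) = 0"
      using transfer(2)[OF _ j, of "\<lambda>x. f x - \<mu>"] fk[of 1] by (simp add: Z_def[abs_def] \<mu>_def prob_space)
    show "expectation (\<lambda>\<omega>. Z j \<omega> ^ 2) \<le> C" "expectation (\<lambda>\<omega>. Z j \<omega> ^ 4) \<le> C"
      using transfer(2)[OF _ j, of "\<lambda>x. (f x - \<mu>) ^ 2"] transfer(2)[OF _ j, of "\<lambda>x. (f x - \<mu>) ^ 4"]
      by (auto simp: C_def Z_def)
  qed (simp add: C_def)
  then show ?thesis
  proof eventually_elim
    case (elim \<omega>)
    have "(\<lambda>n. (\<Sum>j=1..n. Z j \<omega>) / real n + \<mu>) \<longlonglongrightarrow> 0 + \<mu>"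
      by (intro tendsto_add elim tendsto_const)
    \<comment> \<open>Only eventual equality is claimed: at n = 0 the left side is
      \<open>\<mu>\<close> and the right side is 0.\<close>
    moreover have "\<forall>\<^sub>F n in sequentially.
        (\<Sum>j=1..n. Z j \<omega>) / real n + \<mu> = (\<Sum>j=1..n. f (X j \<omega>)) / real n"
      using eventually_gt_at_top[of 0]
      by eventually_elim (simp add: Z_def sum_subtractf field_simps)
    ultimately show ?case unfolding \<mu>_def[symmetric] by (simp add: tendsto_cong)
  qed
qed

section \<open>Moments, moment generating function and variance of one observation\<close>

text \<open>From |y| <= exp |y| follows |y|^k <= exp (k |y|), and this is at most the sum of the two
  exponentials with exponents k y and -k y.\<close>

lemma integrable_power_of_exp:
  fixes Y :: "'a \<Rightarrow> real"
  assumes [measurable]: "random_variable borel Y"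
    and exp: "\<And>t. integrable M (\<lambda>\<omega>. exp (t * Y \<omega>))"
  shows "integrable M (\<lambda>\<omega>. Y \<omega> ^ k)"
proof (rule Bochner_Integration.integrable_bound)
  show "integrable M (\<lambda>\<omega>. exp (real k * Y \<omega>) + exp (- real k * Y \<omega>))"
    by (intro Bochner_Integration.integrable_add exp)
  have "\<bar>y\<bar> ^ k \<le> exp (real k * y) + exp (- real k * y)" for y :: real
  proof -
    have "\<bar>y\<bar> \<le> exp \<bar>y\<bar>" using exp_ge_add_one_self[of "\<bar>y\<bar>"] by linarith
    then have "\<bar>y\<bar> ^ k \<le> exp (real k * \<bar>y\<bar>)"
      unfolding exp_of_nat_mult by (rule power_mono) simp
    also have "\<dots> \<le> exp (real k * y) + exp (- real k * y)" by (auto simp: abs_if)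
    finally show ?thesis .
  qed
  then show "AE \<omega> in M. norm (Y \<omega> ^ k) \<le> norm (exp (real k * Y \<omega>) + exp (- real k * Y \<omega>))"
    by (simp add: power_abs)
qed simp

text \<open>This serves to obtain continuity: a finite convex function on the real line is
  continuous, as the moving-point lemma demands of its limit.\<close>

lemma convex_on_mgf:
  fixes Y :: "'a \<Rightarrow> real"
  assumes exp: "\<And>t. integrable M (\<lambda>\<omega>. exp (t * Y \<omega>))"
  shows "convex_on UNIV (mgf M Y)"
proof (rule convex_onI)
  fix t x y :: real assume "0 < t" "t < 1"
  then have "expectation (\<lambda>\<omega>. exp (((1 - t) *\<^sub>R x + t *\<^sub>R y) * Y \<omega>))
      \<le> expectation (\<lambda>\<omega>. (1 - t) * exp (x * Y \<omega>) + t * exp (y * Y \<omega>))"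
    by (intro integral_mono exp Bochner_Integration.integrable_add integrable_mult_right
        convex_onD[OF convex_on_exp_mult]) auto
  then show "mgf M Y ((1 - t) *\<^sub>R x + t *\<^sub>R y) \<le> (1 - t) * mgf M Y x + t * mgf M Y y"
    using exp by (simp add: mgf_def)
qed simp

text \<open>The population counterpart of \<open>empirical_mgf_eq\<close>; it identifies the limit
  in \<open>liminf_T_stat_ge\<close>.\<close>

lemma mgf_standardized:
  "mgf M (standardized M Y) t = exp (- (t / sqrt (variance Y) * expectation Y)) * mgf M Y (t / sqrt (variance Y))"
proof -
  define m where "m = expectation Y"
  define s where "s = sqrt (expectation (\<lambda>\<omega>. (Y \<omega> - m)\<^sup>2))"
  have "exp (t * ((y - m) / s)) = exp (- (t / s * m)) * exp (t / s * y)" for y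
    by (simp add: diff_divide_distrib right_diff_distrib flip: exp_add)
  then show ?thesis
    unfolding mgf_def standardized_def m_def[symmetric] s_def[symmetric] by simp
qed

lemma variance_pos:
  fixes Y :: "'a \<Rightarrow> real"
  assumes int: "integrable M Y" "integrable M (\<lambda>\<omega>. (Y \<omega>)\<^sup>2)"
    and nondegenerate: "\<not> (\<exists>c. AE \<omega> in M. Y \<omega> = c)"
  shows "variance Y > 0"
proof (rule ccontr)
  have "integrable M (\<lambda>\<omega>. (Y \<omega> - expectation Y)\<^sup>2)"
    using int by (simp add: power2_diff)
  moreover assume "\<not> variance Y > 0"
  then have "variance Y = 0" using variance_positive[of Y] by linarith
  ultimately have "AE \<omega> in M. (Y \<omega> - expectation Y)\<^sup>2 = 0"
    by (subst (asm) integral_nonneg_eq_0_iff_AE) auto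
  then have "AE \<omega> in M. Y \<omega> = expectation Y" by simp
  with nondegenerate show False by blast
qed

section \<open>The almost sure lower bound\<close>

lemma AE_liminf_T_stat_ge:
  fixes X :: "nat \<Rightarrow> 'a \<Rightarrow> real"
  assumes "\<beta> > 1"
    and ind: "indep_vars (\<lambda>_. borel) X {1..}"
    and iid: "\<And>j. j \<ge> 1 \<Longrightarrow> distr M borel (X j) = distr M borel (X 1)"
    and nondegenerate: "\<not> (\<exists>c. AE \<omega> in M. X 1 \<omega> = c)"
    and exp: "\<And>t. integrable M (\<lambda>\<omega>. exp (t * X 1 \<omega>))"
  shows "AE \<omega> in M. mgf_distance \<beta> (mgf M (standardized M (X 1)))
    \<le> liminf (\<lambda>n. ennreal (T_stat \<beta> (\<lambda>j. X j \<omega>) n / real n))"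
proof -
  define \<mu> \<sigma> where "\<mu> = expectation (X 1)" and "\<sigma> = sqrt (variance (X 1))"
  have rv: "random_variable borel (X 1)" using ind by (auto simp: indep_vars_def)
  note int = integrable_power_of_exp[OF rv exp]
  have int1: "integrable M (X 1)" using int[of 1] by simp
  have "variance (X 1) > 0" using int1 int[of 2] nondegenerate by (rule variance_pos)
  then have "\<sigma> > 0" by (simp add: \<sigma>_def)
  have "\<sigma>\<^sup>2 = variance (X 1)" unfolding \<sigma>_def by (rule real_sqrt_pow2) (rule variance_positive)
  then have E2: "expectation (\<lambda>\<omega>. (X 1 \<omega>)\<^sup>2) = \<sigma>\<^sup>2 + \<mu>\<^sup>2"
    using variance_eq[OF int1 int[of 2]] by (simp add: \<mu>_def)
  have "AE \<omega> in M. (\<lambda>n. (\<Sum>j=1..n. X j \<omega>) / real n) \<longlonglongrightarrow> \<mu>"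
    unfolding \<mu>_def by (rule strong_law_fourth_moment[OF ind iid, of "\<lambda>x. x"]) (use int in auto)
  moreover have "AE \<omega> in M. (\<lambda>n. (\<Sum>j=1..n. (X j \<omega>)\<^sup>2) / real n) \<longlonglongrightarrow> \<sigma>\<^sup>2 + \<mu>\<^sup>2"
    unfolding E2[symmetric]
    \<comment> \<open>The fourth moment of the square is the eighth moment of the
      observation.\<close>
    by (rule strong_law_fourth_moment[OF ind iid, of "\<lambda>x. x\<^sup>2"]) (use int[of 8] in \<open>auto simp flip: power_mult\<close>)
  \<comment> \<open>Countability of the rationals gives one null set for all
    \<open>q\<close>.\<close>
  moreover have "AE \<omega> in M. \<forall>q\<in>\<rat>. (\<lambda>n. (\<Sum>j=1..n. exp (q * X j \<omega>)) / real n) \<longlonglongrightarrow> mgf M (X 1) q"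
    unfolding AE_ball_countable[OF countable_rat] mgf_def
  proof
    fix q :: real
    \<comment> \<open>The fourth moment needed here is the moment generating function at
      \<open>4 * q\<close>.\<close>
    have "exp (q * X 1 \<omega>) ^ 4 = exp ((4 * q) * X 1 \<omega>)" for \<omega>
      by (simp flip: exp_of_nat_mult)
    then have "integrable M (\<lambda>\<omega>. exp (q * X 1 \<omega>) ^ 4)" using exp by simp
    then show "AE \<omega> in M. (\<lambda>n. (\<Sum>j=1..n. exp (q * X j \<omega>)) / real n) \<longlonglongrightarrow> expectation (\<lambda>\<omega>. exp (q * X 1 \<omega>))"
      by (intro strong_law_fourth_moment[OF ind iid, of "\<lambda>x. exp (q * x)"]) auto
  qed
  ultimately show ?thesis
  proof eventually_elim
    case (elim \<omega>)
    have "continuous_on UNIV (mgf M (X 1))"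
      by (intro convex_on_continuous convex_on_mgf exp) auto
    then have "mgf_distance \<beta> (\<lambda>t. exp (- (t / \<sigma> * \<mu>)) * mgf M (X 1) (t / \<sigma>))
        \<le> liminf (\<lambda>n. ennreal (T_stat \<beta> (\<lambda>j. X j \<omega>) n / real n))"
      using elim \<open>\<sigma> > 0\<close> \<open>\<beta> > 1\<close> by (intro liminf_T_stat_ge) auto
    then show ?case
      unfolding mgf_standardized[abs_def, of "X 1"] \<sigma>_def \<mu>_def .
  qed
qed

end

theorem theorem3:
  fixes P :: "'a measure" and X :: "nat \<Rightarrow> 'a \<Rightarrow> real" and \<beta> :: real
  assumes "prob_space P"
    and "\<beta> > 2"
    and "prob_space.indep_vars P (\<lambda>_. borel) X {1..}"
    and "\<And>j. j \<ge> 1 \<Longrightarrow> distr P borel (X j) = distr P borel (X 1)"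
    and "continuous_on UNIV (cdf (distr P borel (X 1)))"
    and "\<not> (\<exists>c. AE \<omega> in P. X 1 \<omega> = c)"
    and "\<And>t. integrable P (\<lambda>\<omega>. exp (t * X 1 \<omega>))"
  shows "(AE \<omega> in P. liminf (\<lambda>n. ennreal (T_stat \<beta> (\<lambda>j. X j \<omega>) n / real n))
            \<ge> mgf_distance \<beta> (mgf P (standardized P (X 1))))
       \<and> (prob_space.expectation P (X 1) = 0 \<and> prob_space.variance P (X 1) = 1 \<longrightarrow>
          (AE \<omega> in P. liminf (\<lambda>n. ennreal (T_stat \<beta> (\<lambda>j. X j \<omega>) n / real n))
            \<ge> mgf_distance \<beta> (mgf P (X 1))))"
proof -
  interpret prob_space P by fact
  have main: "AE \<omega> in P. liminf (\<lambda>n. ennreal (T_stat \<beta> (\<lambda>j. X j \<omega>) n / real n))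
      \<ge> mgf_distance \<beta> (mgf P (standardized P (X 1)))"
    using \<open>\<beta> > 2\<close> by (intro AE_liminf_T_stat_ge[OF _ assms(3,4,6,7)]) simp_all
  \<comment> \<open>With mean 0 and variance 1 the second claim is an instance of the first. The
    variance is rewritten before the mean because its expression contains the mean.\<close>
  moreover have "standardized P (X 1) = X 1" if "expectation (X 1) = 0" "variance (X 1) = 1"
    unfolding standardized_def[abs_def] that(2) unfolding that(1) by simp
  ultimately show ?thesis by (intro conjI impI) (assumption, elim conjE, simp only:)
qed

end
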